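(* Let $f,g:\mathbb{R}^n\to\mathbb{R}\cup\{\infty\}$ be proper, lower semicontinuous, convex functions and set $h(x):=\max\{f(x),g(x)\}$ for $x\in\mathbb{R}^n$. Assume that $\mathrm{dom}\,h$ is unbounded and that $$\partial^\infty f(\infty)\cap\bigl(-\partial^\infty g(\infty)\bigr)=\{0\}.$$ Then $$\partial h(\infty)\subset\mathrm{conv}\bigl[\partial f(\infty)\cup\partial g(\infty)\bigr]\;\cup\;\bigl[\partial f(\infty)+\partial^\infty g(\infty)\bigr]\;\cup\;\bigl[\partial g(\infty)+\partial^\infty f(\infty)\bigr].$$
   Context: For $\varphi:\mathbb{R}^n\to\mathbb{R}\cup\{\infty\}$: $\mathrm{dom}\,\varphi=\{x\mid\varphi(x)<\infty\}$; $\varphi$ is proper if $\mathrm{dom}\,\varphi\ne\emptyset$; $\mathrm{epi}\,\varphi=\{(x,r)\in\mathbb{R}^n\times\mathbb{R}\mid r\ge\varphi(x)\}$. $\mathrm{conv}$ denotes convex hull. For $\varphi$ proper, lower semicontinuous, convex with $\mathrm{dom}\,\varphi$ unbounded, and $I=\{1,\dots,n\}$ selecting the $x$-coordinates in $\mathbb{R}^n\times\mathbb{R}$: $T(\infty_I;\mathrm{epi}\,\varphi)$ is the set of $(w,\rho)$ such that for all sequences $(x_k,r_k)\in\mathrm{epi}\,\varphi$ with $\|x_k\|\to\infty$ and all $t_k>0$ with $t_k\to0$ there exist $(w_k,\rho_k)\to(w,\rho)$ with $(x_k,r_k)+t_k(w_k,\rho_k)\in\mathrm{epi}\,\varphi$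 for all $k$. $N(\infty_I;\mathrm{epi}\,\varphi)=\{(u,c)\mid\langle u,w\rangle+c\rho\le0\ \forall(w,\rho)\in T(\infty_I;\mathrm{epi}\,\varphi)\}$. Then $\partial\varphi(\infty)=\{u\mid(u,-1)\in N(\infty_I;\mathrm{epi}\,\varphi)\}$ and $\partial^\infty\varphi(\infty)=\{u\mid(u,0)\in N(\infty_I;\mathrm{epi}\,\varphi)\}$. *)

theory Defs
  imports "HOL-Analysis.Analysis" "HOL-Library.Set_Algebras"
begin

(* Functions into R with infinity adjoined are modelled as ereal-valued functions that avoid
   the value -\<infinity>; the latter is a separate predicate, since "proper" below only
   requires a nonempty effective domain. *)

definition no_minus_inf :: "('a \<Rightarrow> ereal) \<Rightarrow> bool" where
  "no_minus_inf \<phi> \<longleftrightarrow> (\<forall>x. \<phi> x \<noteq> -\<infinity>)"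

definition eff_dom :: "('a \<Rightarrow> ereal) \<Rightarrow> 'a set" where
  "eff_dom \<phi> = {x. \<phi> x < \<infinity>}"

definition proper_fun :: "('a \<Rightarrow> ereal) \<Rightarrow> bool" where
  "proper_fun \<phi> \<longleftrightarrow> eff_dom \<phi> \<noteq> {}"

definition epi :: "('a \<Rightarrow> ereal) \<Rightarrow> ('a \<times> real) set" where
  "epi \<phi> = {(x, r). \<phi> x \<le> ereal r}"

definition lsc_fun :: "('a::topological_space \<Rightarrow> ereal) \<Rightarrow> bool" where
  "lsc_fun \<phi> \<longleftrightarrow> (\<forall>x. \<phi> x \<le> Liminf (at x) \<phi>)"

(* The weights are strictly between 0 and 1, so that no product 0 * \<infinity> occurs. *)

definition convex_fun :: "('a::real_vector \<Rightarrow> ereal) \<Rightarrow> bool" where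
  "convex_fun \<phi> \<longleftrightarrow> (\<forall>x y t. 0 < t \<and> t < 1 \<longrightarrow>
     \<phi> ((1 - t) *\<^sub>R x + t *\<^sub>R y) \<le> ereal (1 - t) * \<phi> x + ereal t * \<phi> y)"

(* Only the first component is required to tend to infinity, corresponding to the index set
   I that selects the x-coordinates of the product space. *)

definition tangent_inf :: "('a::real_normed_vector \<times> real) set \<Rightarrow> ('a \<times> real) set" where
  "tangent_inf \<Omega> = {(w, \<rho>).
     \<forall>(x :: nat \<Rightarrow> 'a) (r :: nat \<Rightarrow> real) (t :: nat \<Rightarrow> real).
       (\<forall>k. (x k, r k) \<in> \<Omega>) \<and> filterlim (\<lambda>k. norm (x k)) at_top sequentially \<and>
       (\<forall>k. 0 < t k) \<and> t \<longlonglongrightarrow> 0 \<longrightarrow>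
       (\<exists>(w' :: nat \<Rightarrow> 'a) (\<rho>' :: nat \<Rightarrow> real).
          (\<lambda>k. (w' k, \<rho>' k)) \<longlonglongrightarrow> (w, \<rho>) \<and>
          (\<forall>k. (x k, r k) + t k *\<^sub>R (w' k, \<rho>' k) \<in> \<Omega>))}"

definition normal_inf :: "('a::real_inner \<times> real) set \<Rightarrow> ('a \<times> real) set" where
  "normal_inf \<Omega> = {(u, c). \<forall>(w, \<rho>) \<in> tangent_inf \<Omega>. u \<bullet> w + c * \<rho> \<le> 0}"

(* The two subdifferentials are intended for functions with unbounded effective domain. *)

definition subdiff_inf :: "('a::real_inner \<Rightarrow> ereal) \<Rightarrow> 'a set" where
  "subdiff_inf \<phi> = {u. (u, -1) \<in> normal_inf (epi \<phi>)}"

definition singular_subdiff_inf :: "('a::real_inner \<Rightarrow> ereal) \<Rightarrow> 'a set" where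
  "singular_subdiff_inf \<phi> = {u. (u, 0) \<in> normal_inf (epi \<phi>)}"

end

theory Submission
  imports Defs
begin

text \<open>The idea is the normal cone intersection rule. The epigraph of \<open>h\<close> is the intersection of
  those of \<open>f\<close> and \<open>g\<close>, and by separation the qualification condition says that the difference of the
  two tangent cones at infinity is the whole space. Given a sequence \<open>z\<^sub>k\<close> in the intersection
  \<open>C \<inter> D\<close> of the epigraphs and step sizes \<open>t\<^sub>k\<close>, the rescaled convex sets \<open>(C - z\<^sub>k) / t\<^sub>k\<close> and \<open>(D - z\<^sub>k) / t\<^sub>k\<close> then have a
  difference that contains a fixed ball around the origin, so a direction approximately tangent
  to both can be corrected to one that is feasible for both. Hence the intersection of the tangent
  cones is tangent to the intersection, and by polarity every normal of \<open>epi h\<close> is a sum of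
  normals of \<open>epi f\<close> and \<open>epi g\<close>. Decomposing \<open>(u, -1)\<close> in this way and rescaling gives the
  three alternatives.\<close>

section \<open>Tangent and normal cones at infinity\<close>

text \<open>Treating each sequence of pairs as one sequence in the product space lets the later
  arguments use vector operations directly.\<close>

lemma tangent_inf_iff:
  "v \<in> tangent_inf \<Omega> \<longleftrightarrow>
    (\<forall>z t. (\<forall>k. z k \<in> \<Omega>) \<and> filterlim (\<lambda>k. norm (fst (z k))) at_top sequentially \<and>
       (\<forall>k. 0 < t k) \<and> t \<longlonglongrightarrow> 0 \<longrightarrow>
       (\<exists>v'. v' \<longlonglongrightarrow> v \<and> (\<forall>k. z k + t k *\<^sub>R v' k \<in> \<Omega>)))" (is "?L \<longleftrightarrow> ?R")
proof
  assume L: ?L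
  show ?R
  proof (intro allI impI, elim conjE)
    fix z and t :: "nat \<Rightarrow> real"
    assume z: "\<forall>k. z k \<in> \<Omega>" "filterlim (\<lambda>k. norm (fst (z k))) at_top sequentially"
      and t: "\<forall>k. 0 < t k" "t \<longlonglongrightarrow> 0"
    have "\<exists>w' \<rho>'. (\<lambda>k. (w' k, \<rho>' k)) \<longlonglongrightarrow> (fst v, snd v) \<and>
        (\<forall>k. (fst (z k), snd (z k)) + t k *\<^sub>R (w' k, \<rho>' k) \<in> \<Omega>)"
      using L[unfolded tangent_inf_def mem_Collect_eq split_beta, rule_format,
          of "\<lambda>k. fst (z k)" "\<lambda>k. snd (z k)" t] z t by simp
    then obtain w' \<rho>' where "(\<lambda>k. (w' k, \<rho>' k)) \<longlonglongrightarrow> v"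
      "\<forall>k. z k + t k *\<^sub>R (w' k, \<rho>' k) \<in> \<Omega>" by auto
    then show "\<exists>v'. v' \<longlonglongrightarrow> v \<and> (\<forall>k. z k + t k *\<^sub>R v' k \<in> \<Omega>)"
      by (intro exI[of _ "\<lambda>k. (w' k, \<rho>' k)"]) simp
  qed
next
  assume R: ?R
  show ?L
    unfolding tangent_inf_def mem_Collect_eq split_beta
  proof (intro allI impI, elim conjE)
    fix x and r t :: "nat \<Rightarrow> real"
    assume x: "\<forall>k. (x k, r k) \<in> \<Omega>" "filterlim (\<lambda>k. norm (x k)) at_top sequentially"
      and t: "\<forall>k. 0 < t k" "t \<longlonglongrightarrow> 0"
    then obtain v' where "v' \<longlonglongrightarrow> v" "\<forall>k. (x k, r k) + t k *\<^sub>R v' k \<in> \<Omega>"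
      using R[rule_format, of "\<lambda>k. (x k, r k)" t] by auto
    then show "\<exists>w' \<rho>'. (\<lambda>k. (w' k, \<rho>' k)) \<longlonglongrightarrow> (fst v, snd v) \<and>
        (\<forall>k. (x k, r k) + t k *\<^sub>R (w' k, \<rho>' k) \<in> \<Omega>)"
      by (intro exI[of _ "\<lambda>k. fst (v' k)"] exI[of _ "\<lambda>k. snd (v' k)"]) simp
  qed
qed

lemma tangent_infI:
  assumes "\<And>z t. \<lbrakk>\<And>k. z k \<in> \<Omega>; filterlim (\<lambda>k. norm (fst (z k))) at_top sequentially;
      \<And>k. 0 < t k; t \<longlonglongrightarrow> 0\<rbrakk> \<Longrightarrow> \<exists>v'. v' \<longlonglongrightarrow> v \<and> (\<forall>k. z k + t k *\<^sub>R v' k \<in> \<Omega>)"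
  shows "v \<in> tangent_inf \<Omega>"
  unfolding tangent_inf_iff using assms by blast

lemma tangent_infE:
  assumes "v \<in> tangent_inf \<Omega>"
    and "\<And>k. z k \<in> \<Omega>" "filterlim (\<lambda>k. norm (fst (z k))) at_top sequentially"
    and "\<And>k. 0 < t k" "t \<longlonglongrightarrow> 0"
  obtains v' where "v' \<longlonglongrightarrow> v" "\<And>k. z k + t k *\<^sub>R v' k \<in> \<Omega>"
  using assms unfolding tangent_inf_iff by meson

lemma zero_in_tangent_inf: "0 \<in> tangent_inf \<Omega>"
  by (rule tangent_infI) (rule exI[of _ "\<lambda>_. 0"], simp)

text \<open>The factor moves into the steps: \<open>t k * c\<close> is again an admissible
  sequence.\<close>

lemma tangent_inf_scaleR:
  assumes "v \<in> tangent_inf \<Omega>" "0 < c"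
  shows "c *\<^sub>R v \<in> tangent_inf \<Omega>"
proof (rule tangent_infI)
  fix z and t :: "nat \<Rightarrow> real"
  assume z: "\<And>k. z k \<in> \<Omega>" "filterlim (\<lambda>k. norm (fst (z k))) at_top sequentially"
    and t: "\<And>k. 0 < t k" "t \<longlonglongrightarrow> 0"
  have "\<And>k. 0 < t k * c" "(\<lambda>k. t k * c) \<longlonglongrightarrow> 0"
    using t assms(2) by (auto intro: tendsto_mult_left_zero)
  with tangent_infE[OF assms(1) z] obtain v'
    where "v' \<longlonglongrightarrow> v" "\<And>k. z k + (t k * c) *\<^sub>R v' k \<in> \<Omega>" by metis
  then show "\<exists>v'. v' \<longlonglongrightarrow> c *\<^sub>R v \<and> (\<forall>k. z k + t k *\<^sub>R v' k \<in> \<Omega>)"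
    by (intro exI[of _ "\<lambda>k. c *\<^sub>R v' k"]) (auto intro!: tendsto_intros)
qed

text \<open>Two steps are made in succession. The first displaces the base points by a null
  sequence, so they still escape to infinity and the tangency of \<open>w\<close> applies at the
  displaced points.\<close>

lemma tangent_inf_add:
  assumes "v \<in> tangent_inf \<Omega>" "w \<in> tangent_inf \<Omega>"
  shows "v + w \<in> tangent_inf \<Omega>"
proof (rule tangent_infI)
  fix z and t :: "nat \<Rightarrow> real"
  assume z: "\<And>k. z k \<in> \<Omega>" "filterlim (\<lambda>k. norm (fst (z k))) at_top sequentially"
    and t: "\<And>k. 0 < t k" "t \<longlonglongrightarrow> 0"
  obtain v' where v': "v' \<longlonglongrightarrow> v" "\<And>k. z k + t k *\<^sub>R v' k \<in> \<Omega>"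
    using tangent_infE[OF assms(1) z t] by blast
  have "(\<lambda>k. fst (t k *\<^sub>R v' k)) \<longlonglongrightarrow> fst (0 *\<^sub>R v)"
    by (intro tendsto_intros t v')
  then have "(\<lambda>k. - norm (fst (t k *\<^sub>R v' k))) \<longlonglongrightarrow> 0"
    using tendsto_minus[OF tendsto_norm] by fastforce
  then have "filterlim (\<lambda>k. - norm (fst (t k *\<^sub>R v' k)) + norm (fst (z k))) at_top sequentially"
    by (rule filterlim_tendsto_add_at_top[OF _ z(2)])
  then have "filterlim (\<lambda>k. norm (fst (z k + t k *\<^sub>R v' k))) at_top sequentially"
  proof (rule filterlim_at_top_mono, intro always_eventually allI)
    fix k
    show "- norm (fst (t k *\<^sub>R v' k)) + norm (fst (z k)) \<le> norm (fst (z k + t k *\<^sub>R v' k))"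
      using norm_diff_ineq[of "fst (z k)" "fst (t k *\<^sub>R v' k)"] by simp
  qed
  from tangent_infE[OF assms(2) v'(2) this t] obtain w'
    where w': "w' \<longlonglongrightarrow> w" "\<And>k. (z k + t k *\<^sub>R v' k) + t k *\<^sub>R w' k \<in> \<Omega>" by blast
  then show "\<exists>u'. u' \<longlonglongrightarrow> v + w \<and> (\<forall>k. z k + t k *\<^sub>R u' k \<in> \<Omega>)"
    using v'(1) by (intro exI[of _ "\<lambda>k. v' k + w' k"])
      (auto intro!: tendsto_intros simp: scaleR_add_right add.assoc)
qed

lemma convex_cone_tangent_inf: "convex_cone (tangent_inf \<Omega>)"
  unfolding convex_cone_iff
proof (intro conjI ballI allI impI)
  show "0 \<in> tangent_inf \<Omega>" by (rule zero_in_tangent_inf)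
  show "v + w \<in> tangent_inf \<Omega>" if "v \<in> tangent_inf \<Omega>" "w \<in> tangent_inf \<Omega>" for v w
    using that by (rule tangent_inf_add)
  show "c *\<^sub>R v \<in> tangent_inf \<Omega>" if "v \<in> tangent_inf \<Omega>" "0 \<le> c" for v c
    using tangent_inf_scaleR[of v \<Omega> c] zero_in_tangent_inf[of \<Omega>] that by (cases "c = 0") auto
qed

lemma normal_inf_iff: "p \<in> normal_inf \<Omega> \<longleftrightarrow> (\<forall>v \<in> tangent_inf \<Omega>. p \<bullet> v \<le> 0)"
  by (cases p) (auto simp: normal_inf_def)

lemma normal_inf_scaleR: "p \<in> normal_inf \<Omega> \<Longrightarrow> 0 \<le> c \<Longrightarrow> c *\<^sub>R p \<in> normal_inf \<Omega>"
  by (simp add: normal_inf_iff mult_nonneg_nonpos)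

section \<open>Separation of convex cones and polars of intersections\<close>

text \<open>A linear functional that is bounded above on a cone is nonpositive there.\<close>

lemma separating_hyperplane_convex_cone:
  fixes K :: "'a::euclidean_space set"
  assumes K: "convex_cone K" and "y \<notin> K"
  obtains q where "q \<noteq> 0" "\<And>x. x \<in> K \<Longrightarrow> q \<bullet> x \<le> 0" "0 \<le> q \<bullet> y"
proof -
  have "K \<noteq> {}" "convex K" "0 \<in> K"
    using K convex_cone_contains_0 by (auto simp: convex_cone_def)
  then obtain q b where q: "q \<noteq> 0" "\<forall>x\<in>K. q \<bullet> x \<le> b" "b \<le> q \<bullet> y"
    using separating_hyperplane_sets[of K "{y}"] assms(2) by auto
  have "0 \<le> b" using q(2) \<open>0 \<in> K\<close> by force
  have "q \<bullet> x \<le> 0" if "x \<in> K" for x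
  proof (rule ccontr)
    assume pos: "\<not> q \<bullet> x \<le> 0"
    \<comment> \<open>The factor is chosen so that \<open>q\<close> takes the value
      \<open>b + 1\<close> here, above its bound \<open>b\<close>.\<close>
    have "((b + 1) / (q \<bullet> x)) *\<^sub>R x \<in> K"
      using K that pos \<open>0 \<le> b\<close> by (simp add: convex_cone_iff)
    from q(2)[rule_format, OF this] pos show False by simp
  qed
  then show thesis using that[of q] q \<open>0 \<le> b\<close> by force
qed

text \<open>The differences form a convex cone. A point outside it would yield a nonzero
  \<open>q\<close> that is nonpositive on it, and testing \<open>q\<close> on \<open>a - 0\<close>
  and \<open>0 - b\<close> contradicts \<open>qual\<close>.\<close>

lemma convex_cone_diff_UNIV:
  fixes A B :: "'a::euclidean_space set"
  assumes A: "convex_cone A" and B: "convex_cone B"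
    and qual: "\<And>q. \<lbrakk>\<And>a. a \<in> A \<Longrightarrow> q \<bullet> a \<le> 0; \<And>b. b \<in> B \<Longrightarrow> 0 \<le> q \<bullet> b\<rbrakk> \<Longrightarrow> q = 0"
  obtains a b where "a \<in> A" "b \<in> B" "y = a - b"
proof -
  define K where "K = (\<lambda>p. fst p - snd p) ` (A \<times> B)"
  have KI: "a - b \<in> K" if "a \<in> A" "b \<in> B" for a b
    unfolding K_def using that by (intro image_eqI[of _ _ "(a, b)"]) auto
  have 0: "0 \<in> A" "0 \<in> B" using A B convex_cone_contains_0 by blast+
  have "convex_cone (A \<times> B)" using A B by (rule convex_cone_Times)
  moreover have "linear (\<lambda>p :: 'a \<times> 'a. fst p - snd p)"
    by (intro linearI) (auto simp: algebra_simps)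
  ultimately have "convex_cone K"
    unfolding K_def by (intro convex_cone_linear_image conjI)
  moreover have "q = 0" if q: "\<And>x. x \<in> K \<Longrightarrow> q \<bullet> x \<le> 0" for q
    by (rule qual) (use q[OF KI[OF _ 0(2)]] q[OF KI[OF 0(1)]] in auto)
  ultimately have "y \<in> K"
    using separating_hyperplane_convex_cone by metis
  then show thesis using that unfolding K_def by auto
qed

text \<open>Separates \<open>(0, 1)\<close> from the cone of all \<open>(a - b, s)\<close> with \<open>s \<le> u \<bullet> a\<close>; the qualification
  condition excludes a vertical hyperplane.\<close>

lemma polar_Int_convex_cone:
  fixes A B :: "'a::euclidean_space set"
  assumes A: "convex_cone A" and B: "convex_cone B"
    and qual: "\<And>q. \<lbrakk>\<And>a. a \<in> A \<Longrightarrow> q \<bullet> a \<le> 0; \<And>b. b \<in> B \<Longrightarrow> 0 \<le> q \<bullet> b\<rbrakk> \<Longrightarrow> q = 0"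
    and u: "\<And>v. \<lbrakk>v \<in> A; v \<in> B\<rbrakk> \<Longrightarrow> u \<bullet> v \<le> 0"
  obtains p q where "u = p + q" "\<And>a. a \<in> A \<Longrightarrow> p \<bullet> a \<le> 0" "\<And>b. b \<in> B \<Longrightarrow> q \<bullet> b \<le> 0"
proof -
  define K where "K = {(a - b, s) |a b s. a \<in> A \<and> b \<in> B \<and> s \<le> u \<bullet> a}"
  have 0: "0 \<in> A" "0 \<in> B" using A B convex_cone_contains_0 by blast+
  have KI: "(a - b, s) \<in> K" if "a \<in> A" "b \<in> B" "s \<le> u \<bullet> a" for a b s
    using that unfolding K_def by blast
  have "convex_cone K"
    unfolding convex_cone_iff
  proof (intro conjI ballI allI impI)
    show "0 \<in> K" using KI[OF 0, of 0] by (simp add: zero_prod_def)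
    show "x + y \<in> K" if xy: "x \<in> K" "y \<in> K" for x y
    proof -
      obtain a b s a' b' s' where eq: "x = (a - b, s)" "y = (a' - b', s')"
        and m: "a \<in> A" "b \<in> B" "s \<le> u \<bullet> a" "a' \<in> A" "b' \<in> B" "s' \<le> u \<bullet> a'"
        using xy unfolding K_def by blast
      have "((a + a') - (b + b'), s + s') \<in> K"
        by (rule KI) (use m A B in \<open>auto simp: convex_cone_iff inner_add_right\<close>)
      then show ?thesis by (simp add: eq algebra_simps)
    qed
    show "c *\<^sub>R x \<in> K" if xc: "x \<in> K" "0 \<le> c" for x c
    proof -
      obtain a b s where eq: "x = (a - b, s)" and m: "a \<in> A" "b \<in> B" "s \<le> u \<bullet> a"
        using xc unfolding K_def by blast
      have "(c *\<^sub>R a - c *\<^sub>R b, c * s) \<in> K"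
        by (rule KI) (use m xc A B in \<open>auto simp: convex_cone_iff mult_left_mono\<close>)
      then show ?thesis by (simp add: eq algebra_simps)
    qed
  qed
  \<comment> \<open>Membership would force \<open>a = b\<close>, a common point of both cones with
    \<open>1 \<le> u \<bullet> a\<close>.\<close>
  moreover have "(0, 1) \<notin> K" using u unfolding K_def by fastforce
  ultimately obtain z where z: "z \<noteq> 0" "\<And>x. x \<in> K \<Longrightarrow> z \<bullet> x \<le> 0" "0 \<le> z \<bullet> (0, 1)"
    using separating_hyperplane_convex_cone by metis
  obtain q \<tau> where zq: "z = (q, \<tau>)" by (cases z)
  have sep: "q \<bullet> (a - b) + \<tau> * s \<le> 0" if "a \<in> A" "b \<in> B" "s \<le> u \<bullet> a" for a b s
    using z(2)[OF KI[OF that]] by (simp add: zq)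
  have "\<tau> \<ge> 0" using z(3) by (simp add: zq)
  have "\<tau> \<noteq> 0"
  proof
    assume "\<tau> = 0"
    have "q = 0"
      by (rule qual) (use sep[OF _ 0(2) order_refl] sep[OF 0(1) _ order_refl] \<open>\<tau> = 0\<close> in auto)
    with \<open>\<tau> = 0\<close> z(1) zq show False by (simp add: zero_prod_def)
  qed
  show thesis
  proof
    \<comment> \<open>In \<open>sep\<close>, the choice \<open>b = 0\<close>,
      \<open>s = u \<bullet> a\<close> bounds the first summand on \<open>A\<close>, and
      \<open>a = 0\<close>, \<open>s = 0\<close> bounds the second on \<open>B\<close>.\<close>
    show "u = (u + q /\<^sub>R \<tau>) + - (q /\<^sub>R \<tau>)" by simp
    show "(u + q /\<^sub>R \<tau>) \<bullet> a \<le> 0" if "a \<in> A" for a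
    proof -
      have "(\<tau> *\<^sub>R (u + q /\<^sub>R \<tau>)) \<bullet> a \<le> 0"
        using sep[OF that 0(2) order_refl] \<open>\<tau> \<noteq> 0\<close> by (simp add: scaleR_add_right inner_add_left)
      then show ?thesis using \<open>\<tau> \<ge> 0\<close> \<open>\<tau> \<noteq> 0\<close> by (simp add: mult_le_0_iff)
    qed
    show "- (q /\<^sub>R \<tau>) \<bullet> b \<le> 0" if "b \<in> B" for b
      using sep[OF 0(1) that, of 0] \<open>\<tau> \<ge> 0\<close> by simp
  qed
qed

section \<open>Uniform covering and correction for convex sets\<close>

text \<open>A functional \<open>u\<close> separating \<open>y\<close> from \<open>S\<close> is at
  least \<open>norm u / DIM('a)\<close> at some signed basis vector. A nearby point of
  \<open>S\<close> loses at most half of that, which still exceeds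
  \<open>u \<bullet> y\<close>.\<close>

lemma convex_contains_ball:
  fixes S :: "'a::euclidean_space set"
  assumes "convex S"
    and near: "\<And>b. b \<in> Basis \<Longrightarrow> \<exists>s\<in>S. dist s b \<le> 1 / (2 * DIM('a))"
      "\<And>b. b \<in> Basis \<Longrightarrow> \<exists>s\<in>S. dist s (- b) \<le> 1 / (2 * DIM('a))"
  shows "ball 0 (1 / (2 * DIM('a))) \<subseteq> S"
proof
  fix y :: 'a assume y: "y \<in> ball 0 (1 / (2 * DIM('a)))"
  show "y \<in> S"
  proof (rule ccontr)
    assume "y \<notin> S"
    moreover have "S \<noteq> {}" using near(1) nonempty_Basis by fast
    ultimately obtain u b where u: "u \<noteq> 0" "\<forall>s\<in>S. u \<bullet> s \<le> b" "b \<le> u \<bullet> y"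
      using separating_hyperplane_sets[of S "{y}"] assms(1) by auto
    \<comment> \<open>The largest coordinate is at least the average, and the coordinates sum in
      absolute value to at least \<open>norm u\<close>.\<close>
    have "\<exists>e\<in>Basis. norm u / DIM('a) \<le> \<bar>u \<bullet> e\<bar>"
    proof (rule ccontr)
      assume "\<not> ?thesis"
      then have "(\<Sum>e\<in>Basis. \<bar>u \<bullet> e\<bar>) < (\<Sum>e\<in>(Basis::'a set). norm u / DIM('a))"
        by (intro sum_strict_mono) auto
      also have "\<dots> = norm u" by simp
      finally show False using norm_le_l1[of u] by simp
    qed
    then obtain e where e: "e \<in> Basis" "norm u / DIM('a) \<le> \<bar>u \<bullet> e\<bar>" by blast
    define e' where "e' = (if 0 \<le> u \<bullet> e then e else - e)"
    have e': "norm u / DIM('a) \<le> u \<bullet> e'" using e by (auto simp: e'_def)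
    obtain s where s: "s \<in> S" "dist s e' \<le> 1 / (2 * DIM('a))"
      using near e(1) unfolding e'_def by metis
    have "\<bar>u \<bullet> (s - e')\<bar> \<le> norm u * norm (s - e')" by (rule Cauchy_Schwarz_ineq2)
    also have "\<dots> \<le> norm u * (1 / (2 * DIM('a)))"
      using s(2) by (intro mult_left_mono) (auto simp: dist_norm)
    finally have "u \<bullet> s \<ge> norm u * (1 / (2 * DIM('a)))"
      using e' by (simp add: inner_diff_right field_simps abs_le_iff)
    moreover have "u \<bullet> y \<le> norm u * norm y" by (rule norm_cauchy_schwarz)
    moreover have "norm u * norm y < norm u * (1 / (2 * DIM('a)))"
      using y u(1) by (intro mult_strict_left_mono) auto
    ultimately show False using u s(1) by force
  qed
qed

text \<open>Cutting \<open>A\<close> down to \<open>cball 0 M\<close> before forming differences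
  keeps the set convex and gives every represented \<open>y\<close> the same bound on
  \<open>a\<close>.\<close>

lemma convex_differences_cover:
  fixes A B :: "'a::euclidean_space set"
  assumes "convex A" "convex B"
    and near: "\<And>e. e \<in> Basis \<union> uminus ` Basis \<Longrightarrow>
      \<exists>a\<in>A. \<exists>b\<in>B. norm a \<le> M \<and> dist (a - b) e \<le> 1 / (2 * DIM('a))"
    and y: "norm y < 1 / (2 * DIM('a))"
  shows "\<exists>a\<in>A. \<exists>b\<in>B. norm a \<le> M \<and> y = a - b"
proof -
  define S where "S = (\<Union>x\<in>A \<inter> cball 0 M. \<Union>y\<in>B. {x - y})"
  have "convex S"
    unfolding S_def by (intro convex_differences convex_Int assms convex_cball)
  moreover have "\<exists>s\<in>S. dist s e \<le> 1 / (2 * DIM('a))" if "e \<in> Basis \<union> uminus ` Basis" for e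
    using near[OF that] unfolding S_def by fastforce
  ultimately have "ball 0 (1 / (2 * DIM('a))) \<subseteq> S"
    by (intro convex_contains_ball) auto
  then have "y \<in> S" using y by auto
  then show ?thesis by (auto simp: S_def)
qed

text \<open>Pick \<open>a - b\<close> of length \<open>\<rho>\<close> pointing opposite to
  \<open>p - q\<close>. Mixing \<open>a\<close> into \<open>p\<close> and \<open>b\<close> into
  \<open>q\<close> with one common weight closes the gap, and the weight is at most
  \<open>norm (p - q) / \<rho>\<close>.\<close>

lemma convex_Int_correction:
  fixes A B :: "'a::real_normed_vector set"
  assumes "convex A" "convex B" "p \<in> A" "q \<in> B" "0 < \<rho>"
    and cover: "\<And>y. norm y < 2 * \<rho> \<Longrightarrow> \<exists>a\<in>A. \<exists>b\<in>B. norm a \<le> M \<and> y = a - b"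
  shows "\<exists>w \<in> A \<inter> B. dist w p \<le> norm (p - q) * ((M + norm p) / \<rho>)"
proof (cases "p = q")
  case True
  then show ?thesis using assms by (intro bexI[of _ p]) auto
next
  case False
  define n where "n = norm (p - q)"
  have n: "0 < n" using False by (simp add: n_def)
  obtain a b where ab: "a \<in> A" "b \<in> B" "norm a \<le> M" "(- \<rho> / n) *\<^sub>R (p - q) = a - b"
    using cover[of "(- \<rho> / n) *\<^sub>R (p - q)"] n \<open>0 < \<rho>\<close> by (auto simp: n_def[symmetric])
  \<comment> \<open>The weight solves \<open>(1 - l) * n = l * \<rho>\<close>, which makes the two
    combinations coincide.\<close>
  define l where "l = n / (\<rho> + n)"
  have l: "0 \<le> l" "l \<le> 1" "l \<le> n / \<rho>" "l * \<rho> = (1 - l) * n"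
    using n \<open>0 < \<rho>\<close> by (auto simp: l_def field_simps)
  define w where "w = (1 - l) *\<^sub>R p + l *\<^sub>R a"
  have "w \<in> A" unfolding w_def using assms ab l by (intro convexD) auto
  moreover have "w = (1 - l) *\<^sub>R q + l *\<^sub>R b"
  proof -
    have "w - ((1 - l) *\<^sub>R q + l *\<^sub>R b) = (1 - l) *\<^sub>R (p - q) + l *\<^sub>R (a - b)"
      by (simp add: w_def algebra_simps)
    also have "\<dots> = ((1 - l) - l * \<rho> / n) *\<^sub>R (p - q)"
      by (simp add: ab(4)[symmetric] algebra_simps)
    also have "\<dots> = 0" using l(4) n by simp
    finally show ?thesis by simp
  qed
  then have "w \<in> B" using assms ab l by (auto intro: convexD)
  moreover have "dist w p \<le> n * ((M + norm p) / \<rho>)"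
  proof -
    have "w - p = l *\<^sub>R (a - p)" by (simp add: w_def algebra_simps)
    then have "dist w p = l * norm (a - p)" using l by (simp add: dist_norm)
    also have "\<dots> \<le> (n / \<rho>) * (M + norm p)"
      using l ab(3) norm_triangle_ineq4[of a p] by (intro mult_mono) auto
    finally show ?thesis by simp
  qed
  ultimately show ?thesis unfolding n_def by blast
qed

section \<open>Intersection rules for tangent and normal cones\<close>

text \<open>The approximations \<open>p\<close> and \<open>q\<close> of \<open>v\<close> differ by a
  null sequence, while the factor in the correction estimate stays bounded, so the corrected
  directions also tend to \<open>v\<close>.\<close>

lemma tangent_inf_Int:
  fixes C D :: "('a::euclidean_space \<times> real) set"
  assumes C: "convex C" and D: "convex D"
    and diff: "\<And>y. \<exists>a\<in>tangent_inf C. \<exists>b\<in>tangent_inf D. y = a - b"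
    and vC: "v \<in> tangent_inf C" and vD: "v \<in> tangent_inf D"
  shows "v \<in> tangent_inf (C \<inter> D)"
proof (rule tangent_infI)
  fix z and t :: "nat \<Rightarrow> real"
  assume "\<And>k. z k \<in> C \<inter> D" and lim: "filterlim (\<lambda>k. norm (fst (z k))) at_top sequentially"
    and t: "\<And>k. 0 < t k" "t \<longlonglongrightarrow> 0"
  then have zC: "\<And>k. z k \<in> C" and zD: "\<And>k. z k \<in> D" by auto
  define A where "A k = {w. z k + t k *\<^sub>R w \<in> C}" for k
  define B where "B k = {w. z k + t k *\<^sub>R w \<in> D}" for k
  have preimage: "convex {w. y + s *\<^sub>R w \<in> S}" if "convex S" for y s and S :: "('a \<times> real) set"
  proof (rule convexI)
    fix w w' and c d :: real
    assume w: "w \<in> {w. y + s *\<^sub>R w \<in> S}" "w' \<in> {w. y + s *\<^sub>R w \<in> S}"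
      and cd: "0 \<le> c" "0 \<le> d" "c + d = 1"
    then have "c *\<^sub>R (y + s *\<^sub>R w) + d *\<^sub>R (y + s *\<^sub>R w') \<in> S"
      using that by (intro convexD) auto
    also have "c *\<^sub>R (y + s *\<^sub>R w) + d *\<^sub>R (y + s *\<^sub>R w') = (c + d) *\<^sub>R y + s *\<^sub>R (c *\<^sub>R w + d *\<^sub>R w')"
      by (simp add: algebra_simps)
    finally show "c *\<^sub>R w + d *\<^sub>R w' \<in> {w. y + s *\<^sub>R w \<in> S}" using cd by simp
  qed
  have AB: "convex (A k)" "convex (B k)" for k
    unfolding A_def B_def by (intro preimage C D)+
  have approx: "\<exists>s. s \<longlonglongrightarrow> a \<and> (\<forall>k. s k \<in> A k)" if "a \<in> tangent_inf C" for a
    using tangent_infE[OF that zC lim t] by (auto simp: A_def)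
  have approx': "\<exists>s. s \<longlonglongrightarrow> a \<and> (\<forall>k. s k \<in> B k)" if "a \<in> tangent_inf D" for a
    using tangent_infE[OF that zD lim t] by (auto simp: B_def)
  obtain p where p: "p \<longlonglongrightarrow> v" "\<And>k. p k \<in> A k" using approx[OF vC] by blast
  obtain q where q: "q \<longlonglongrightarrow> v" "\<And>k. q k \<in> B k" using approx'[OF vD] by blast
  \<comment> \<open>Half the radius of the ball covered by differences, as the correction lemma asks
    for radius \<open>2 * \<rho>\<close>.\<close>
  define \<rho> :: real where "\<rho> = 1 / (4 * DIM('a \<times> real))"
  have \<rho>: "0 < \<rho>" "2 * \<rho> = 1 / (2 * DIM('a \<times> real))"
    by (simp_all add: \<rho>_def field_simps)
  have "\<forall>y. \<exists>a b a0. a \<longlonglongrightarrow> a0 \<and> (\<lambda>k. a k - b k) \<longlonglongrightarrow> y \<and> (\<forall>k. a k \<in> A k) \<and> (\<forall>k. b k \<in> B k)"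
  proof
    fix y
    obtain a0 b0 where ab0: "a0 \<in> tangent_inf C" "b0 \<in> tangent_inf D" "y = a0 - b0"
      using diff by blast
    then show "\<exists>a b a0. a \<longlonglongrightarrow> a0 \<and> (\<lambda>k. a k - b k) \<longlonglongrightarrow> y \<and> (\<forall>k. a k \<in> A k) \<and> (\<forall>k. b k \<in> B k)"
      using approx[of a0] approx'[of b0] by (blast intro: tendsto_diff)
  qed
  then obtain a b a0 where ab: "\<And>y. a y \<longlonglongrightarrow> a0 y" "\<And>y. (\<lambda>k. a y k - b y k) \<longlonglongrightarrow> y"
      "\<And>y k. a y k \<in> A k" "\<And>y k. b y k \<in> B k"
    by metis
  \<comment> \<open>Only these finitely many directions need approximating, so one bound
    \<open>M\<close> and one threshold for \<open>k\<close> serve them all.\<close>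
  define E :: "('a \<times> real) set" where "E = Basis \<union> uminus ` Basis"
  have "finite E" by (simp add: E_def)
  \<comment> \<open>The added 1 puts \<open>M\<close> strictly above every limit norm, so the
    approximating sequences are eventually below \<open>M\<close>.\<close>
  define M where "M = (\<Sum>y\<in>E. norm (a0 y) + 1)"
  have "norm (a0 y) < M" if "y \<in> E" for y
  proof -
    have "norm (a0 y) + 1 \<le> M"
      unfolding M_def by (rule member_le_sum) (use that \<open>finite E\<close> in auto)
    then show ?thesis by simp
  qed
  then have "\<forall>y\<in>E. \<forall>\<^sub>F k in sequentially. norm (a y k) < M \<and> dist (a y k - b y k) y < 2 * \<rho>"
    using ab(1,2) \<rho>(1)
    by (intro ballI eventually_conj order_tendstoD(2)[OF tendsto_norm] tendstoD) auto
  then have ev: "\<forall>\<^sub>F k in sequentially. \<forall>y\<in>E. norm (a y k) < M \<and> dist (a y k - b y k) y < 2 * \<rho>"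
    using \<open>finite E\<close> by (simp add: eventually_ball_finite)
  define P where "P k w \<longleftrightarrow> w \<in> A k \<inter> B k \<and> dist w (p k) \<le> norm (p k - q k) * ((M + norm (p k)) / \<rho>)"
    for k w
  have evP: "\<forall>\<^sub>F k in sequentially. \<exists>w. P k w"
    using ev
  proof eventually_elim
    case (elim k)
    have "\<exists>a'\<in>A k. \<exists>b'\<in>B k. norm a' \<le> M \<and> dist (a' - b') e \<le> 1 / (2 * DIM('a \<times> real))"
      if "e \<in> Basis \<union> uminus ` Basis" for e
      using elim that ab(3,4) unfolding E_def \<rho>(2) by (meson less_imp_le)
    then have cov: "\<exists>a\<in>A k. \<exists>b\<in>B k. norm a \<le> M \<and> y = a - b" if "norm y < 2 * \<rho>" for y
      by (rule convex_differences_cover[OF AB _ that[unfolded \<rho>(2)]])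
    show ?case
      using convex_Int_correction[OF AB p(2) q(2) \<rho>(1) cov] unfolding P_def by blast
  qed
  \<comment> \<open>Corrections exist only for large \<open>k\<close>. Elsewhere the default 0 is
    feasible because \<open>z k\<close> lies in both sets.\<close>
  define w where "w k = (if \<exists>w. P k w then SOME w. P k w else 0)" for k
  have wP: "P k (w k)" if "\<exists>w. P k w" for k
    using someI_ex[OF that] that by (simp add: w_def)
  have wAB: "w k \<in> A k \<inter> B k" for k
  proof (cases "\<exists>w. P k w")
    case True
    then show ?thesis using wP[OF True] by (simp add: P_def)
  next
    case False
    then have "w k = 0" by (simp add: w_def)
    then show ?thesis using zC zD by (simp add: A_def B_def)
  qed
  have "(\<lambda>k. norm (p k - q k) * ((M + norm (p k)) / \<rho>)) \<longlonglongrightarrow> norm (v - v) * ((M + norm v) / \<rho>)"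
    using \<rho>(1) by (intro tendsto_intros p q) auto
  then have "(\<lambda>k. norm (p k - q k) * ((M + norm (p k)) / \<rho>)) \<longlonglongrightarrow> 0" by simp
  moreover have "\<forall>\<^sub>F k in sequentially. norm (w k - p k) \<le> norm (p k - q k) * ((M + norm (p k)) / \<rho>)"
    using evP by eventually_elim (use wP in \<open>auto simp: P_def dist_norm\<close>)
  ultimately have "(\<lambda>k. w k - p k) \<longlonglongrightarrow> 0" by (rule Lim_null_comparison[rotated])
  from tendsto_add[OF this p(1)] have "w \<longlonglongrightarrow> v" by simp
  then show "\<exists>v'. v' \<longlonglongrightarrow> v \<and> (\<forall>k. z k + t k *\<^sub>R v' k \<in> C \<inter> D)"
    using wAB by (intro exI[of _ w]) (auto simp: A_def B_def)
qed

text \<open>The qualification condition enters twice: it makes the differences of tangents fill the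
  space, and it lets the polar of the intersection split into a sum.\<close>

lemma normal_inf_Int:
  fixes C D :: "('a::euclidean_space \<times> real) set"
  assumes C: "convex C" and D: "convex D"
    and qual: "\<And>p. p \<in> normal_inf C \<Longrightarrow> - p \<in> normal_inf D \<Longrightarrow> p = 0"
  shows "normal_inf (C \<inter> D) \<subseteq> normal_inf C + normal_inf D"
proof
  fix u assume u: "u \<in> normal_inf (C \<inter> D)"
  have qual': "q = 0" if "\<And>a. a \<in> tangent_inf C \<Longrightarrow> q \<bullet> a \<le> 0" "\<And>b. b \<in> tangent_inf D \<Longrightarrow> 0 \<le> q \<bullet> b" for q
    using qual that by (simp add: normal_inf_iff)
  note cones = convex_cone_tangent_inf[of C] convex_cone_tangent_inf[of D]
  have "\<exists>a\<in>tangent_inf C. \<exists>b\<in>tangent_inf D. y = a - b" for y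
    using convex_cone_diff_UNIV[OF cones qual'] by metis
  then have "u \<bullet> v \<le> 0" if "v \<in> tangent_inf C" "v \<in> tangent_inf D" for v
    using tangent_inf_Int[OF C D _ that] u by (simp add: normal_inf_iff)
  then obtain p q where "u = p + q" "\<And>a. a \<in> tangent_inf C \<Longrightarrow> p \<bullet> a \<le> 0"
      "\<And>b. b \<in> tangent_inf D \<Longrightarrow> q \<bullet> b \<le> 0"
    using polar_Int_convex_cone[OF cones qual'] by metis
  then show "u \<in> normal_inf C + normal_inf D"
    by (auto simp: normal_inf_iff intro!: set_plus_intro)
qed

section \<open>Epigraphs and the subdifferentials of the maximum\<close>

lemma convex_epi:
  assumes "convex_fun \<phi>"
  shows "convex (epi \<phi>)"
  unfolding convex_alt
proof (intro ballI allI impI)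
  fix p q and t :: real
  assume pq: "p \<in> epi \<phi>" "q \<in> epi \<phi>" and t: "0 \<le> t \<and> t \<le> 1"
  obtain x r y s where eq: "p = (x, r)" "q = (y, s)" by (cases p, cases q)
  \<comment> \<open>The endpoints are separate because \<open>convex_fun\<close> speaks only of
    weights strictly between 0 and 1.\<close>
  consider "t = 0" | "t = 1" | "0 < t" "t < 1" using t by linarith
  then show "(1 - t) *\<^sub>R p + t *\<^sub>R q \<in> epi \<phi>"
  proof cases
    case 3
    then have "\<phi> ((1 - t) *\<^sub>R x + t *\<^sub>R y) \<le> ereal (1 - t) * \<phi> x + ereal t * \<phi> y"
      using assms by (simp add: convex_fun_def)
    also have "\<dots> \<le> ereal (1 - t) * ereal r + ereal t * ereal s"
      using pq 3 by (intro add_mono ereal_mult_left_mono) (auto simp: eq epi_def)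
    finally show ?thesis by (simp add: eq epi_def)
  qed (use pq in auto)
qed

text \<open>Raising a point keeps it in the epigraph, so the upward direction is tangent, with a
  constant sequence as witness.\<close>

lemma normal_inf_epi_nonpos:
  assumes "(u, c) \<in> normal_inf (epi \<phi>)"
  shows "c \<le> 0"
proof -
  have "(0, 1) \<in> tangent_inf (epi \<phi>)"
  proof (rule tangent_infI)
    fix z :: "nat \<Rightarrow> _" and t :: "nat \<Rightarrow> real"
    assume z: "\<And>k. z k \<in> epi \<phi>" and t: "\<And>k. 0 < t k"
    have "z k + t k *\<^sub>R (0, 1) \<in> epi \<phi>" for k
    proof -
      have "\<phi> (fst (z k)) \<le> ereal (snd (z k))" using z[of k] by (auto simp: epi_def)
      also have "\<dots> \<le> ereal (snd (z k) + t k)" using t[of k] by simp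
      finally show ?thesis by (cases "z k") (simp add: epi_def)
    qed
    then show "\<exists>v'. v' \<longlonglongrightarrow> (0, 1) \<and> (\<forall>k. z k + t k *\<^sub>R v' k \<in> epi \<phi>)"
      by (intro exI[of _ "\<lambda>_. (0, 1)"]) simp
  qed
  with assms show ?thesis unfolding normal_inf_iff by force
qed

lemma subdiff_inf_normalize:
  assumes "(u, - s) \<in> normal_inf (epi \<phi>)" "0 < s"
  shows "u /\<^sub>R s \<in> subdiff_inf \<phi>"
  using normal_inf_scaleR[OF assms(1), of "inverse s"] assms(2) by (simp add: subdiff_inf_def)

theorem proposition4p22:
  fixes f g h :: "real ^ 'n \<Rightarrow> ereal"
  assumes "no_minus_inf f" "proper_fun f" "lsc_fun f" "convex_fun f"
    and "no_minus_inf g" "proper_fun g" "lsc_fun g" "convex_fun g"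
    and "h = (\<lambda>x. max (f x) (g x))"
    and "\<not> bounded (eff_dom h)"
    and "singular_subdiff_inf f \<inter> uminus ` singular_subdiff_inf g = {0}"
  shows "subdiff_inf h \<subseteq>
    convex hull (subdiff_inf f \<union> subdiff_inf g)
      \<union> (subdiff_inf f + singular_subdiff_inf g)
      \<union> (subdiff_inf g + singular_subdiff_inf f)"
proof
  fix u assume "u \<in> subdiff_inf h"
  then have u: "(u, -1) \<in> normal_inf (epi h)" by (simp add: subdiff_inf_def)
  \<comment> \<open>Both \<open>c\<close> and \<open>- c\<close> are nonpositive, so such a normal
    is horizontal and the assumption on singular subdifferentials applies.\<close>
  have "p = 0" if p: "p \<in> normal_inf (epi f)" "- p \<in> normal_inf (epi g)" for p
  proof -
    obtain x c where eq: "p = (x, c)" by (cases p)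
    have "c = 0" using normal_inf_epi_nonpos[of x c f] normal_inf_epi_nonpos[of "- x" "- c" g] p eq by simp
    then have "x \<in> singular_subdiff_inf f" "- x \<in> singular_subdiff_inf g"
      using p eq by (simp_all add: singular_subdiff_inf_def)
    then have "x \<in> singular_subdiff_inf f \<inter> uminus ` singular_subdiff_inf g"
      by (auto intro: image_eqI[of _ _ "- x"])
    then show ?thesis using assms(11) eq \<open>c = 0\<close> by (simp add: zero_prod_def)
  qed
  then have "normal_inf (epi f \<inter> epi g) \<subseteq> normal_inf (epi f) + normal_inf (epi g)"
    using assms(4,8) by (intro normal_inf_Int convex_epi)
  moreover have "epi h = epi f \<inter> epi g" by (auto simp: epi_def assms(9))
  ultimately have "(u, -1) \<in> normal_inf (epi f) + normal_inf (epi g)"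
    using u by (simp add: subset_iff)
  then obtain p q where pq: "(u, -1) = p + q" "p \<in> normal_inf (epi f)" "q \<in> normal_inf (epi g)"
    by (rule set_plus_elim)
  obtain a b s where s: "u = a + b" "(a, - s) \<in> normal_inf (epi f)" "(b, - (1 - s)) \<in> normal_inf (epi g)"
  \<comment> \<open>The last components of \<open>p\<close> and \<open>q\<close> add up to -1, so
    \<open>s\<close> is minus that of \<open>p\<close>, and \<open>1 - s\<close> is minus that of
    \<open>q\<close>.\<close>
  proof
    show "u = fst p + fst q" using pq(1) by (metis fst_add fst_conv)
    show "(fst p, - (- snd p)) \<in> normal_inf (epi f)" using pq(2) by simp
    have "- (1 - - snd p) = snd q" using arg_cong[OF pq(1), of snd] by simp
    then show "(fst q, - (1 - - snd p)) \<in> normal_inf (epi g)" using pq(3) by (metis prod.collapse)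
  qed
  have "0 \<le> s" "s \<le> 1"
    using normal_inf_epi_nonpos[OF s(2)] normal_inf_epi_nonpos[OF s(3)] by auto
  \<comment> \<open>At an endpoint one normal is horizontal and gives a singular subgradient. In
    between both can be normalised, and \<open>s\<close>, \<open>1 - s\<close> become convex
    weights.\<close>
  then consider "s = 0" | "s = 1" | "0 < s" "s < 1" by linarith
  then show "u \<in> convex hull (subdiff_inf f \<union> subdiff_inf g)
      \<union> (subdiff_inf f + singular_subdiff_inf g)
      \<union> (subdiff_inf g + singular_subdiff_inf f)"
  proof cases
    case 1
    then have "b + a \<in> subdiff_inf g + singular_subdiff_inf f"
      using s by (intro set_plus_intro) (auto simp: subdiff_inf_def singular_subdiff_inf_def)
    then show ?thesis using s(1) by (simp add: add.commute)
  next
    case 2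
    then have "a + b \<in> subdiff_inf f + singular_subdiff_inf g"
      using s by (intro set_plus_intro) (auto simp: subdiff_inf_def singular_subdiff_inf_def)
    then show ?thesis using s(1) by simp
  next
    case 3
    have "a /\<^sub>R s \<in> subdiff_inf f" "b /\<^sub>R (1 - s) \<in> subdiff_inf g"
      using subdiff_inf_normalize[OF s(2)] subdiff_inf_normalize[OF s(3)] 3 by auto
    then have "s *\<^sub>R (a /\<^sub>R s) + (1 - s) *\<^sub>R (b /\<^sub>R (1 - s)) \<in> convex hull (subdiff_inf f \<union> subdiff_inf g)"
      using 3 by (intro convexD[OF convex_convex_hull] hull_inc) auto
    then show ?thesis using 3 s(1) by simp
  qed
qed

end
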